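(* Let $(W,S)$ be a finite Coxeter system and $I\subseteq S$. Then there is a percolating sequence of subsets of $W/W_I$ starting from $\{W_I\}$; that is, there is a finite folding sequence $J_0,J_1,\dots,J_N$ of subsets of $W/W_I$ with $J_0=\{W_I\}$ and $J_N=W/W_I$.
   Context: A finite Coxeter system $(W,S)$: $W$ is a finite group with generating set $S=\{s_1,\dots,s_m\}$ and presentation $\langle s_1,\dots,s_m \mid (s_is_j)^{m_{ij}}=1\rangle$, $m_{ii}=1$, $m_{ij}=m_{ji}\ge2$ for $i\ne j$. $\ell(w)$ is the length of $w$ (minimum number of generators from $S$ in a product equal to $w$). $T=\{usu^{-1}:s\in S,u\in W\}$ is the set of reflections. For $I\subseteq S$, $W_I=\langle I\rangle$, and $w^I$ is the unique minimum-length element of the coset $wW_I$. For $t\in T$ define $L^I_t=\{wW_I:\ell((tw)^I)>\ell(w^I)\}$, $R^I_t=\{wW_I:\ell((tw)^I)<\ell(w^I)\}$, $F^I_t=\{wW_I:\ell((tw)^I)=\ell(w^I)\}$. The left-folding map $t^+$ on $W/W_I$ sends $wW_I$ to $twW_I$ if $wW_I\in R^I_t$ and fixes it otherwise; the right-folding map $t^-$ sends $wW_I$ to $twW_I$ if $wW_I\in L^I_t$ and fixes it otherwise. For $J\subseteq W/W_I$, $J^+(t)=\{wW_I: t^+(wW_I)\in J\}$ and $J^-(t)=\{wW_I:t^-(wW_I)\in J\}$. A folding sequence is a sequence $J_0,J_1,\dots$ of subsets of $W/W_I$ such that for each $i$ there is $t_i\in T$ with $J_{i+1}=J_i^+(t_i)$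 or $J_{i+1}=J_i^-(t_i)$. A percolating sequence is a finite folding sequence starting from a one-element set and ending with $W/W_I$. *)

theory Defs
  imports "HOL-Algebra.Generated_Groups" "HOL-Algebra.Left_Coset"
begin

text \<open>A word over the signed alphabet; the letter \<open>(s, True)\<close> stands for \<open>s\<close> and
  \<open>(s, False)\<close> for its formal inverse.\<close>

type_synonym 'a signed_word = "('a \<times> bool) list"

definition signed_words :: "'a set \<Rightarrow> 'a signed_word set" where
  "signed_words S = lists (S \<times> UNIV)"

text \<open>The quotient of the words over \<open>S\<close> by this congruence is the group
  \<open>\<langle>S | R\<rangle>\<close>, i.e. the free group on \<open>S\<close> modulo the normal closure of \<open>R\<close>.\<close>

inductive presentation_cong ::
    "'a set \<Rightarrow> 'a signed_word set \<Rightarrow> 'a signed_word \<Rightarrow> 'a signed_word \<Rightarrow> bool"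
  for S :: "'a set" and R :: "'a signed_word set" where
  refl: "u \<in> signed_words S \<Longrightarrow> presentation_cong S R u u"
| sym: "presentation_cong S R u v \<Longrightarrow> presentation_cong S R v u"
| trans: "presentation_cong S R u v \<Longrightarrow> presentation_cong S R v w \<Longrightarrow> presentation_cong S R u w"
| cancel: "u \<in> signed_words S \<Longrightarrow> v \<in> signed_words S \<Longrightarrow> s \<in> S \<Longrightarrow>
    presentation_cong S R (u @ [(s, b), (s, \<not> b)] @ v) (u @ v)"
| relator: "u \<in> signed_words S \<Longrightarrow> v \<in> signed_words S \<Longrightarrow> r \<in> R \<Longrightarrow>
    presentation_cong S R (u @ r @ v) (u @ v)"

definition eval_signed_word :: "('a, 'b) monoid_scheme \<Rightarrow> 'a signed_word \<Rightarrow> 'a" where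
  "eval_signed_word G w =
     foldr (\<lambda>(s, b) x. (if b then s else inv\<^bsub>G\<^esub> s) \<otimes>\<^bsub>G\<^esub> x) w \<one>\<^bsub>G\<^esub>"

text \<open>\<open>G\<close> has presentation \<open>\<langle>S | R\<rangle>\<close>: evaluation induces a well-defined bijection from
  the group of the presentation onto \<open>G\<close>.\<close>

definition has_presentation ::
    "('a, 'b) monoid_scheme \<Rightarrow> 'a set \<Rightarrow> 'a signed_word set \<Rightarrow> bool" where
  "has_presentation G S R \<longleftrightarrow>
     S \<subseteq> carrier G \<and> R \<subseteq> signed_words S \<and> generate G S = carrier G \<and>
     (\<forall>u\<in>signed_words S. \<forall>v\<in>signed_words S.
        eval_signed_word G u = eval_signed_word G v \<longleftrightarrow> presentation_cong S R u v)"

definition coxeter_relator :: "'a \<Rightarrow> 'a \<Rightarrow> nat \<Rightarrow> 'a signed_word" where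
  "coxeter_relator s t n = concat (replicate n [(s, True), (t, True)])"

text \<open>Since the group is finite, no \<open>m s t\<close> is infinite, so \<open>m\<close> takes values in \<open>nat\<close>.\<close>

definition finite_coxeter_system :: "('a, 'b) monoid_scheme \<Rightarrow> 'a set \<Rightarrow> bool" where
  "finite_coxeter_system G S \<longleftrightarrow>
     group G \<and> finite (carrier G) \<and>
     (\<exists>m :: 'a \<Rightarrow> 'a \<Rightarrow> nat.
        (\<forall>s\<in>S. m s s = 1) \<and>
        (\<forall>s\<in>S. \<forall>t\<in>S. s \<noteq> t \<longrightarrow> m s t = m t s \<and> m s t \<ge> 2) \<and>
        has_presentation G S {coxeter_relator s t (m s t) | s t. s \<in> S \<and> t \<in> S})"

definition cox_length :: "('a, 'b) monoid_scheme \<Rightarrow> 'a set \<Rightarrow> 'a \<Rightarrow> nat" where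
  "cox_length G S w =
     (LEAST n. \<exists>ss. set ss \<subseteq> S \<and> length ss = n \<and> foldr (mult G) ss \<one>\<^bsub>G\<^esub> = w)"

definition reflections :: "('a, 'b) monoid_scheme \<Rightarrow> 'a set \<Rightarrow> 'a set" where
  "reflections G S = {u \<otimes>\<^bsub>G\<^esub> s \<otimes>\<^bsub>G\<^esub> inv\<^bsub>G\<^esub> u | s u. s \<in> S \<and> u \<in> carrier G}"

definition parabolic_cosets :: "('a, 'b) monoid_scheme \<Rightarrow> 'a set \<Rightarrow> 'a set set" where
  "parabolic_cosets G I = lcosets\<^bsub>G\<^esub> (generate G I)"

text \<open>\<open>min_rep G S I w\<close> is \<open>w\<^sup>I\<close>.\<close>

definition min_rep :: "('a, 'b) monoid_scheme \<Rightarrow> 'a set \<Rightarrow> 'a set \<Rightarrow> 'a \<Rightarrow> 'a" where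
  "min_rep G S I w =
     (THE x. x \<in> w <#\<^bsub>G\<^esub> generate G I \<and>
        (\<forall>y \<in> w <#\<^bsub>G\<^esub> generate G I. cox_length G S x \<le> cox_length G S y))"

definition L_cosets :: "('a, 'b) monoid_scheme \<Rightarrow> 'a set \<Rightarrow> 'a set \<Rightarrow> 'a \<Rightarrow> 'a set set" where
  "L_cosets G S I t = {w <#\<^bsub>G\<^esub> generate G I | w. w \<in> carrier G \<and>
     cox_length G S (min_rep G S I (t \<otimes>\<^bsub>G\<^esub> w)) > cox_length G S (min_rep G S I w)}"

definition R_cosets :: "('a, 'b) monoid_scheme \<Rightarrow> 'a set \<Rightarrow> 'a set \<Rightarrow> 'a \<Rightarrow> 'a set set" where
  "R_cosets G S I t = {w <#\<^bsub>G\<^esub> generate G I | w. w \<in> carrier G \<and>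
     cox_length G S (min_rep G S I (t \<otimes>\<^bsub>G\<^esub> w)) < cox_length G S (min_rep G S I w)}"

text \<open>The translate \<open>t <# C\<close> of a coset \<open>C = w <# H\<close> is the coset \<open>(t \<otimes> w) <# H\<close>.\<close>

definition left_fold ::
    "('a, 'b) monoid_scheme \<Rightarrow> 'a set \<Rightarrow> 'a set \<Rightarrow> 'a \<Rightarrow> 'a set \<Rightarrow> 'a set" where
  "left_fold G S I t C = (if C \<in> R_cosets G S I t then t <#\<^bsub>G\<^esub> C else C)"

definition right_fold ::
    "('a, 'b) monoid_scheme \<Rightarrow> 'a set \<Rightarrow> 'a set \<Rightarrow> 'a \<Rightarrow> 'a set \<Rightarrow> 'a set" where
  "right_fold G S I t C = (if C \<in> L_cosets G S I t then t <#\<^bsub>G\<^esub> C else C)"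

text \<open>\<open>J\<^sup>+(t)\<close> and \<open>J\<^sup>-(t)\<close>.\<close>

definition fold_plus ::
    "('a, 'b) monoid_scheme \<Rightarrow> 'a set \<Rightarrow> 'a set \<Rightarrow> 'a \<Rightarrow> 'a set set \<Rightarrow> 'a set set" where
  "fold_plus G S I t J = {C \<in> parabolic_cosets G I. left_fold G S I t C \<in> J}"

definition fold_minus ::
    "('a, 'b) monoid_scheme \<Rightarrow> 'a set \<Rightarrow> 'a set \<Rightarrow> 'a \<Rightarrow> 'a set set \<Rightarrow> 'a set set" where
  "fold_minus G S I t J = {C \<in> parabolic_cosets G I. right_fold G S I t C \<in> J}"

text \<open>A finite sequence \<open>J\<^sub>0, \<dots>, J\<^sub>N\<close> is the nonempty list of its \<open>N + 1\<close> terms.\<close>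

definition finite_folding_sequence ::
    "('a, 'b) monoid_scheme \<Rightarrow> 'a set \<Rightarrow> 'a set \<Rightarrow> 'a set set list \<Rightarrow> bool" where
  "finite_folding_sequence G S I Js \<longleftrightarrow>
     Js \<noteq> [] \<and> (\<forall>J \<in> set Js. J \<subseteq> parabolic_cosets G I) \<and>
     (\<forall>i. Suc i < length Js \<longrightarrow>
        (\<exists>t \<in> reflections G S.
           Js ! Suc i = fold_plus G S I t (Js ! i) \<or> Js ! Suc i = fold_minus G S I t (Js ! i)))"

definition percolating_sequence ::
    "('a, 'b) monoid_scheme \<Rightarrow> 'a set \<Rightarrow> 'a set \<Rightarrow> 'a set set list \<Rightarrow> bool" where
  "percolating_sequence G S I Js \<longleftrightarrow>
     finite_folding_sequence G S I Js \<and> (\<exists>C. hd Js = {C}) \<and> last Js = parabolic_cosets G I"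

end

theory Submission
  imports Defs
begin

text \<open>Left-foldings by simple reflections suffice. If \<open>w\<close> is the minimal representative of a coset
  \<open>C \<noteq> W\<^sub>I\<close> and \<open>s\<close> is the first letter of a reduced word for \<open>w\<close>, then \<open>s\<^sup>+\<close> sends \<open>C\<close> to a coset
  with a shorter minimal representative; moreover every \<open>s\<^sup>+\<close> fixes \<open>W\<^sub>I\<close>. Hence the cosets can be
  brought to \<open>W\<^sub>I\<close> one after the other by a single composition of such maps, and its fibre over
  \<open>W\<^sub>I\<close>, which is all of \<open>W/W\<^sub>I\<close>, is the last term of a folding sequence.

  Uniqueness of minimal representatives comes from the deletion property. That property holds
  because the parity of the number of occurrences of a reflection among the
  \<open>s\<^sub>1 \<dots> s\<^sub>i \<dots> s\<^sub>1\<close> is unchanged by the defining relations, hence depends only on the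
  product \<open>s\<^sub>1 \<dots> s\<^sub>n\<close>.\<close>

section \<open>Occurrences and splittings in lists\<close>

lemma count_list_distinct: "distinct xs \<Longrightarrow> x \<in> set xs \<Longrightarrow> count_list xs x = 1"
  by (induction xs) auto

text \<open>Serves to locate, in a concatenation, the letters that deletion removes.\<close>

lemma append_eq_append_ConsE:
  assumes "xs @ hs = ys @ b # us"
  obtains (left) vs where "xs = ys @ b # vs" "us = vs @ hs"
    | (right) vs where "hs = vs @ b # us" "xs @ vs = ys"
  using assms by (auto simp: append_eq_append_conv2 append_eq_Cons_conv)

section \<open>Words in the generators and their relations\<close>

locale coxeter_presentation = group G for G :: "('a, 'b) monoid_scheme" (structure) +
  fixes S :: "'a set" and m :: "'a \<Rightarrow> 'a \<Rightarrow> nat"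
  assumes m_diag: "s \<in> S \<Longrightarrow> m s s = 1"
    and presentation: "has_presentation G S {coxeter_relator s t (m s t) | s t. s \<in> S \<and> t \<in> S}"
begin

abbreviation relators :: "'a signed_word set" where
  "relators \<equiv> {coxeter_relator s t (m s t) | s t. s \<in> S \<and> t \<in> S}"

definition word_prod :: "'a list \<Rightarrow> 'a" where
  "word_prod xs = foldr (\<otimes>) xs \<one>"

text \<open>For a word \<open>s\<^sub>1 ... s\<^sub>n\<close> over \<open>S\<close> the i-th entry
  is the reflection \<open>s\<^sub>1 ... s\<^sub>i ... s\<^sub>1\<close>. Conjugation uses
  \<open>inv s\<close>, so that the append law holds for words over the whole carrier.\<close>

fun refl_seq :: "'a list \<Rightarrow> 'a list" where
  "refl_seq [] = []"
| "refl_seq (s # w) = s # map (\<lambda>t. s \<otimes> t \<otimes> inv s) (refl_seq w)"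

lemma word_prod_Nil [simp]: "word_prod [] = \<one>"
  and word_prod_Cons [simp]: "word_prod (s # w) = s \<otimes> word_prod w"
  by (simp_all add: word_prod_def)

lemma S_carrier: "S \<subseteq> carrier G"
  using presentation by (simp add: has_presentation_def)

lemma S_closed [simp]: "s \<in> S \<Longrightarrow> s \<in> carrier G"
  using S_carrier by blast

lemma word_prod_closed [simp]: "set xs \<subseteq> carrier G \<Longrightarrow> word_prod xs \<in> carrier G"
  by (induction xs) auto

lemma word_prod_append [simp]:
  "set xs \<subseteq> carrier G \<Longrightarrow> set ys \<subseteq> carrier G \<Longrightarrow>
    word_prod (xs @ ys) = word_prod xs \<otimes> word_prod ys"
  by (induction xs) (auto simp: m_assoc)

lemma eval_eq_iff_cong:
  "u \<in> signed_words S \<Longrightarrow> v \<in> signed_words S \<Longrightarrow>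
    eval_signed_word G u = eval_signed_word G v \<longleftrightarrow> presentation_cong S relators u v"
  using presentation by (simp add: has_presentation_def)

lemma relators_signed: "r \<in> relators \<Longrightarrow> r \<in> signed_words S"
  using presentation unfolding has_presentation_def by blast

lemma eval_relator: "r \<in> relators \<Longrightarrow> eval_signed_word G r = \<one>"
  using presentation_cong.relator[of "[]" S "[]" r relators]
    eval_eq_iff_cong[of r "[]"] relators_signed[of r]
  by (simp add: signed_words_def eval_signed_word_def)

lemma gen_square: assumes "s \<in> S" shows "s \<otimes> s = \<one>"
proof -
  have "coxeter_relator s s (m s s) \<in> relators" using assms by blast
  from eval_relator[OF this] show ?thesis using assms
    by (simp add: m_diag coxeter_relator_def eval_signed_word_def)
qed

lemma inv_gen [simp]: "s \<in> S \<Longrightarrow> inv s = s"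
  using gen_square by (simp add: inv_equality)

text \<open>Generators are involutions, so the signs do not affect the value.\<close>

lemma eval_eq_word_prod: "u \<in> signed_words S \<Longrightarrow> eval_signed_word G u = word_prod (map fst u)"
  unfolding signed_words_def
  by (induction u) (auto simp: eval_signed_word_def)

lemma signed_words_fst: "u \<in> signed_words S \<Longrightarrow> set (map fst u) \<subseteq> S"
  by (auto simp: signed_words_def)

section \<open>Reflection sequences and their parity invariant\<close>

lemma set_refl_seq: "set xs \<subseteq> carrier G \<Longrightarrow> set (refl_seq xs) \<subseteq> carrier G"
  by (induction xs) auto

lemma length_refl_seq [simp]: "length (refl_seq xs) = length xs"
  by (induction xs) auto

text \<open>Conjugations by the letters of \<open>xs\<close> compose to conjugation by
  \<open>word_prod xs\<close>; a block of product \<open>\<one>\<close> thus leaves the entries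
  after it unchanged.\<close>

lemma refl_seq_append:
  "set xs \<subseteq> carrier G \<Longrightarrow> set ys \<subseteq> carrier G \<Longrightarrow>
    refl_seq (xs @ ys) =
      refl_seq xs @ map (\<lambda>t. word_prod xs \<otimes> t \<otimes> inv (word_prod xs)) (refl_seq ys)"
proof (induction xs)
  case Nil
  then show ?case using set_refl_seq[of ys]
    by (auto intro!: map_idI[symmetric])
next
  case (Cons a xs)
  then show ?case using set_refl_seq[of ys]
    by (auto simp: m_assoc inv_mult_group)
qed

text \<open>A block \<open>s t\<close> put in front contributes \<open>s\<close> and
  \<open>s t s\<close>, the exponents 0 and 1, and conjugates the older entries by
  \<open>s \<otimes> t\<close>, which raises each exponent by 2.\<close>

lemma refl_seq_alternating:
  assumes "s \<in> S" "t \<in> S"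
  shows "refl_seq (concat (replicate n [s, t])) = map (\<lambda>k. (s \<otimes> t) [^] k \<otimes> s) [0..<2 * n]"
proof (induction n)
  case 0
  then show ?case by simp
next
  case (Suc n)
  have shift: "[0..<2 * Suc n] = 0 # 1 # map (\<lambda>k. k + 2) [0..<2 * n]"
    using map_add_upt[of 2 "2 * n"] by (simp add: upt_conv_Cons numeral_2_eq_2 del: upt_Suc)
  have conj: "s \<otimes> (t \<otimes> ((s \<otimes> t) [^] k \<otimes> s) \<otimes> t) \<otimes> s = (s \<otimes> t) [^] (k + 2) \<otimes> s" for k :: nat
  proof -
    have "(s \<otimes> t) [^] (k + 2) = (s \<otimes> t) \<otimes> (s \<otimes> t) [^] k \<otimes> (s \<otimes> t)"
      using assms by (simp add: nat_pow_Suc2[symmetric] del: nat_pow_Suc)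
    then show ?thesis using assms by (simp add: m_assoc)
  qed
  show ?case
    using assms Suc unfolding shift by (simp add: conj del: upt_Suc)
qed

text \<open>The relator has product \<open>\<one>\<close>, so powers of \<open>s \<otimes> t\<close>
  repeat after \<open>m s t\<close> steps and the \<open>2 * m s t\<close> entries run twice through
  one list. Every reflection thus occurs an even number of times.\<close>

lemma refl_seq_relator:
  assumes "r \<in> relators"
  obtains A where "refl_seq (map fst r) = A @ A"
proof -
  obtain s t where st: "s \<in> S" "t \<in> S" and r: "r = coxeter_relator s t (m s t)"
    using assms by blast
  let ?n = "m s t"
  have map_r: "map fst r = concat (replicate ?n [s, t])"
    by (simp add: r coxeter_relator_def map_concat)
  have "word_prod (concat (replicate k [s, t])) = (s \<otimes> t) [^] k" for k
  proof (induction k)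
    case (Suc k)
    then have "word_prod (concat (replicate (Suc k) [s, t])) = (s \<otimes> t) \<otimes> (s \<otimes> t) [^] k"
      using st by (simp add: m_assoc)
    then show ?case using st nat_pow_Suc2[of "s \<otimes> t" k] by simp
  qed simp
  with eval_relator[OF assms] eval_eq_word_prod[OF relators_signed[OF assms]] map_r
  have pow: "(s \<otimes> t) [^] ?n = \<one>" by metis
  have "[0..<2 * ?n] = [0..<?n] @ map (\<lambda>k. k + ?n) [0..<?n]"
    using map_add_upt[of ?n ?n] upt_add_eq_append[of 0 ?n ?n] by (simp add: mult_2)
  then have "refl_seq (map fst r) = map (\<lambda>k. (s \<otimes> t) [^] k \<otimes> s) [0..<?n]
      @ map (\<lambda>k. (s \<otimes> t) [^] k \<otimes> s) [0..<?n]"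
    using st pow by (simp add: map_r refl_seq_alternating nat_pow_mult[symmetric])
  with that show thesis .
qed

text \<open>A cancelling pair adds one reflection twice and a relator adds one list twice. Both have
  product \<open>\<one>\<close>, so the entries of the remaining letters stay the same.\<close>

lemma refl_parity_cong:
  assumes "presentation_cong S relators u v"
  shows "odd (count_list (refl_seq (map fst u)) t) \<longleftrightarrow> odd (count_list (refl_seq (map fst v)) t)"
  using assms
proof (induction rule: presentation_cong.induct)
  case (cancel u v s b)
  have 1: "set (map fst u) \<subseteq> carrier G" "set (map fst v) \<subseteq> carrier G"
    using cancel signed_words_fst S_carrier by blast+
  have 2: "s \<otimes> (s \<otimes> t \<otimes> s) \<otimes> s = t" if "t \<in> carrier G" for t
    using that cancel gen_square by (metis S_closed m_assoc m_closed l_one r_one)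
  have 3: "s \<otimes> s \<otimes> s = s" using cancel by (simp add: gen_square)
  have "refl_seq ([s, s] @ map fst v) = [s, s] @ refl_seq (map fst v)"
    using cancel set_refl_seq[OF 1(2)] by (auto simp: 2 3 intro!: map_idI)
  then show ?case using 1 cancel
    by (simp add: refl_seq_append)
next
  case (relator u v r)
  have 1: "set (map fst u) \<subseteq> carrier G" "set (map fst v) \<subseteq> carrier G" "set (map fst r) \<subseteq> carrier G"
    using relator relators_signed signed_words_fst S_carrier by blast+
  have e: "word_prod (map fst r) = \<one>"
    using eval_relator[OF relator.hyps(3)]
      eval_eq_word_prod[OF relators_signed[OF relator.hyps(3)]] by simp
  obtain A where A: "refl_seq (map fst r) = A @ A" using refl_seq_relator[OF relator.hyps(3)] by metis
  have "refl_seq (map fst r @ map fst v) = A @ A @ refl_seq (map fst v)"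
    using set_refl_seq[OF 1(2)] 1 by (auto simp: refl_seq_append A e intro!: map_idI)
  then show ?case using 1
    by (auto simp: refl_seq_append)
qed auto

text \<open>With every sign set to \<open>True\<close> the two words have equal value, and the
  presentation makes them congruent.\<close>

lemma refl_parity_word_prod:
  assumes "set xs \<subseteq> S" "set ys \<subseteq> S" "word_prod xs = word_prod ys"
  shows "odd (count_list (refl_seq xs) t) \<longleftrightarrow> odd (count_list (refl_seq ys) t)"
proof -
  let ?f = "map (\<lambda>s. (s, True))"
  have signed: "?f xs \<in> signed_words S" "?f ys \<in> signed_words S"
    using assms by (auto simp: signed_words_def)
  have fst: "map fst (?f zs) = zs" for zs :: "'a list" by (simp add: comp_def)
  have "presentation_cong S relators (?f xs) (?f ys)"
    using eval_eq_iff_cong[OF signed] assms(3) eval_eq_word_prod[OF signed(1)]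
      eval_eq_word_prod[OF signed(2)] unfolding fst by simp
  from refl_parity_cong[OF this, of t] show ?thesis unfolding fst .
qed

section \<open>Word length, exchange and deletion\<close>

lemma word_generate: "set xs \<subseteq> I \<Longrightarrow> word_prod xs \<in> generate G I"
  by (induction xs) (auto intro: generate.intros)

lemma generate_word:
  assumes "I \<subseteq> S" "x \<in> generate G I"
  obtains xs where "set xs \<subseteq> I" "word_prod xs = x"
proof -
  have "\<exists>xs. set xs \<subseteq> I \<and> word_prod xs = x"
    using assms(2)
  proof induction
    case one
    then show ?case by (auto intro: exI[of _ "[]"])
  next
    case (incl h)
    then show ?case using assms(1) by (auto intro!: exI[of _ "[h]"] simp: subset_iff)
  next
    case (inv h)
    then show ?case using assms(1) by (auto intro!: exI[of _ "[h]"] simp: subset_iff)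
  next
    case (eng g h)
    then obtain xs ys where "set xs \<subseteq> I" "word_prod xs = g" "set ys \<subseteq> I" "word_prod ys = h"
      by blast
    moreover have "I \<subseteq> carrier G" using assms(1) S_carrier by blast
    ultimately show ?case by (intro exI[of _ "xs @ ys"]) auto
  qed
  with that show thesis by blast
qed

lemma reduced_word:
  assumes "x \<in> carrier G"
  obtains xs where "set xs \<subseteq> S" "word_prod xs = x" "length xs = cox_length G S x"
proof -
  obtain ys where "set ys \<subseteq> S" "word_prod ys = x"
    using generate_word[of S x] assms presentation by (auto simp: has_presentation_def)
  then have "\<exists>n ss. set ss \<subseteq> S \<and> length ss = n \<and> foldr (\<otimes>) ss \<one> = x"
    unfolding word_prod_def by blast
  from LeastI_ex[OF this] that show thesis
    unfolding cox_length_def word_prod_def by blast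
qed

lemma cox_length_le: "set xs \<subseteq> S \<Longrightarrow> cox_length G S (word_prod xs) \<le> length xs"
  unfolding cox_length_def word_prod_def by (rule Least_le) blast

text \<open>In a distinct sequence each entry occurs exactly once, so by parity it also occurs in
  the sequence of a reduced word for the same element. That word would then have at least
  \<open>length xs\<close> letters.\<close>

lemma not_reduced_not_distinct:
  assumes "set xs \<subseteq> S" "cox_length G S (word_prod xs) < length xs"
  shows "\<not> distinct (refl_seq xs)"
proof
  assume d: "distinct (refl_seq xs)"
  have "word_prod xs \<in> carrier G" using assms(1) S_carrier by (simp add: subset_trans)
  then obtain ys where ys: "set ys \<subseteq> S" "word_prod ys = word_prod xs"
    "length ys = cox_length G S (word_prod xs)"
    using reduced_word by blast
  have "set (refl_seq xs) \<subseteq> set (refl_seq ys)"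
  proof
    fix t assume "t \<in> set (refl_seq xs)"
    then have "odd (count_list (refl_seq xs) t)" using d by (simp add: count_list_distinct)
    then have "odd (count_list (refl_seq ys) t)"
      using refl_parity_word_prod[OF assms(1) ys(1)] ys(2) by simp
    then show "t \<in> set (refl_seq ys)" by (metis count_list_0_iff even_zero)
  qed
  then have "card (set (refl_seq xs)) \<le> length ys"
    by (metis card_length card_mono List.finite_set length_refl_seq le_trans)
  then show False using d assms(2) ys(3) by (simp add: distinct_card)
qed

text \<open>Left multiplication by the i-th entry
  \<open>s\<^sub>1 ... s\<^sub>i ... s\<^sub>1\<close> strikes out the i-th letter, since squares of
  generators cancel.\<close>

lemma refl_seq_delete:
  assumes "set w \<subseteq> S" "t \<in> set (refl_seq w)"
  shows "\<exists>ys b us. w = ys @ b # us \<and> t \<otimes> word_prod w = word_prod (ys @ us)"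
  using assms
proof (induction w arbitrary: t)
  case (Cons s w)
  have w: "set w \<subseteq> carrier G" "s \<in> S" using Cons.prems S_carrier by auto
  show ?case
  proof (cases "t = s")
    case True
    have "s \<otimes> (s \<otimes> word_prod w) = word_prod w"
      using w gen_square by (simp add: m_assoc[symmetric])
    then show ?thesis using True by (intro exI[of _ "[]"]) auto
  next
    case False
    then obtain t' where t': "t' \<in> set (refl_seq w)" "t = s \<otimes> t' \<otimes> s"
      using Cons.prems w by auto
    moreover have "set w \<subseteq> S" using Cons.prems by simp
    ultimately obtain ys b us where "w = ys @ b # us" "t' \<otimes> word_prod w = word_prod (ys @ us)"
      using Cons.IH by blast
    moreover have "t' \<in> carrier G" using t' set_refl_seq[OF w(1)] by blast
    then have "t \<otimes> (s \<otimes> word_prod w) = s \<otimes> (t' \<otimes> ((s \<otimes> s) \<otimes> word_prod w))"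
      using w t' by (simp add: m_assoc)
    then have "t \<otimes> (s \<otimes> word_prod w) = s \<otimes> (t' \<otimes> word_prod w)"
      using w by (simp add: gen_square)
    ultimately show ?thesis by (intro exI[of _ "s # ys"]) auto
  qed
qed simp

lemma deletion:
  assumes "set w \<subseteq> S" "cox_length G S (word_prod w) < length w"
  shows "\<exists>ys a zs b us. w = ys @ a # zs @ b # us \<and> word_prod w = word_prod (ys @ zs @ us)"
  using assms(1) not_reduced_not_distinct[OF assms]
\<comment> \<open>The induction carries the repetition in \<open>refl_seq\<close>, not the length
  bound: either the tail has its own repetition, or the first entry \<open>s\<close> recurs among
  the conjugated ones.\<close>
proof (induction w)
  case (Cons s w)
  have w: "set w \<subseteq> carrier G" "set w \<subseteq> S" "s \<in> S" using Cons.prems S_carrier by auto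
  show ?case
  proof (cases "distinct (refl_seq w)")
    case True
    have "inj_on (\<lambda>t. s \<otimes> t \<otimes> inv s) (set (refl_seq w))"
      using set_refl_seq[OF w(1)] w by (auto intro!: inj_onI simp: subset_iff)
    then obtain t where t: "t \<in> set (refl_seq w)" "s = s \<otimes> t \<otimes> s"
      using True Cons.prems w by (auto simp: distinct_map)
    have "t \<in> carrier G" using t set_refl_seq[OF w(1)] by blast
    \<comment> \<open>Undoing the conjugation by \<open>s\<close> gives \<open>s\<close> again. So
      \<open>s\<close> is an entry for \<open>w\<close>, and the deleted pair is the leading
      \<open>s\<close> and a letter of \<open>w\<close>.\<close>
    with t w have "t = s"
      by (metis S_closed gen_square inv_equality inv_gen l_cancel_one' m_assoc m_closed)
    with t have "s \<in> set (refl_seq w)" by simp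
    from refl_seq_delete[OF w(2) this] show ?thesis
      by (metis append_Nil word_prod_Cons)
  next
    case False
    then obtain ys a zs b us where "w = ys @ a # zs @ b # us"
      "word_prod w = word_prod (ys @ zs @ us)"
      using Cons w by blast
    then show ?thesis by (intro exI[of _ "s # ys"]) auto
  qed
qed simp

section \<open>Uniqueness of minimal coset representatives\<close>

context
  fixes I assumes I_S: "I \<subseteq> S"
begin

abbreviation W\<^sub>I where "W\<^sub>I \<equiv> generate G I"

lemma WI_subgroup: "subgroup W\<^sub>I G"
  using I_S S_carrier by (intro generate_is_subgroup) blast

lemma coset_self: "w \<in> carrier G \<Longrightarrow> w \<in> w <# W\<^sub>I"
  using subgroup.one_closed[OF WI_subgroup] by (force simp: l_coset_def)

text \<open>Append to a reduced word of \<open>x\<close> a shortest word over \<open>I\<close> for \<open>h\<close>. If \<open>h \<noteq> \<one>\<close>, two letters can be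
  deleted: not both from the second word, and any other choice yields an element of \<open>x W\<^sub>I\<close>
  shorter than \<open>x\<close>.\<close>

lemma min_in_coset_unique:
  assumes x: "x \<in> carrier G" "\<And>h. h \<in> W\<^sub>I \<Longrightarrow> cox_length G S x \<le> cox_length G S (x \<otimes> h)"
    and h: "h \<in> W\<^sub>I" "cox_length G S (x \<otimes> h) \<le> cox_length G S x"
  shows "h = \<one>"
proof -
  define P where "P hs \<longleftrightarrow> set hs \<subseteq> I \<and> word_prod hs = h" for hs
  obtain ks where "P ks" using generate_word[OF I_S h(1)] unfolding P_def by blast
  then obtain hs where hs: "P hs" and hs_min: "\<And>ks. P ks \<Longrightarrow> length hs \<le> length ks"
    using ex_has_least_nat[of P ks length] by blast
  obtain xs where xs: "set xs \<subseteq> S" "word_prod xs = x" "length xs = cox_length G S x"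
    using reduced_word[OF x(1)] by blast
  have hsI: "set hs \<subseteq> I" "word_prod hs = h" using hs by (auto simp: P_def)
  have car: "set xs \<subseteq> carrier G" "set hs \<subseteq> carrier G" "I \<subseteq> carrier G"
    using xs hsI I_S S_carrier by blast+
  show ?thesis
  proof (rule ccontr)
    assume "h \<noteq> \<one>"
    then have "hs \<noteq> []" using hsI by auto
    have "set (xs @ hs) \<subseteq> S" using xs hsI I_S by auto
    moreover have xh: "word_prod (xs @ hs) = x \<otimes> h" using car xs hsI by simp
    moreover have "cox_length G S (x \<otimes> h) < length (xs @ hs)"
      using \<open>hs \<noteq> []\<close> h xs by (metis add_less_cancel_left le_less_trans length_append
          length_greater_0_conv less_add_same_cancel1)
    ultimately obtain ys a zs b us where
      dec: "xs @ hs = ys @ a # zs @ b # us" and eq: "x \<otimes> h = word_prod (ys @ zs @ us)"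
      using deletion[of "xs @ hs"] by metis
    have "xs @ hs = (ys @ a # zs) @ b # us" using dec by simp
    then consider
      (in_xs) vs where "xs = ys @ a # zs @ b # vs" "us = vs @ hs"
      | (right) vs where "hs = vs @ b # us" "xs @ vs = ys @ a # zs"
      by (rule append_eq_append_ConsE) auto
    then show False
    proof cases
      case in_xs
      \<comment> \<open>Both letters lie in \<open>xs\<close>: cancelling \<open>h\<close> on the
        right leaves too short a word for \<open>x\<close>.\<close>
      have yc: "set (ys @ zs @ vs) \<subseteq> carrier G" using in_xs car by auto
      have "x \<otimes> h = word_prod ((ys @ zs @ vs) @ hs)" using eq in_xs by simp
      also have "\<dots> = word_prod (ys @ zs @ vs) \<otimes> h"
        using word_prod_append[OF yc car(2)] hsI by simp
      finally have "x = word_prod (ys @ zs @ vs)"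
        using x(1) word_prod_closed[OF yc] subgroup.mem_carrier[OF WI_subgroup h(1)]
        by (metis right_cancel)
      moreover have "set (ys @ zs @ vs) \<subseteq> S" using xs in_xs by auto
      ultimately show False using cox_length_le[of "ys @ zs @ vs"] in_xs xs by simp
    next
      case right
      then consider (mixed) ws where "xs = ys @ a # ws" "zs = ws @ vs"
        | (in_hs) ws where "vs = ws @ a # zs" "ys = xs @ ws"
        by (auto elim: append_eq_append_ConsE)
      then show False
      proof cases
        case mixed
        \<comment> \<open>One letter lies in each word. What survives of \<open>hs\<close> has
          product \<open>?k\<close> in \<open>W\<^sub>I\<close>, so \<open>?y\<close> lies in the
          coset of \<open>x\<close> but has a word one letter shorter than
          \<open>xs\<close>.\<close>
        let ?k = "word_prod (vs @ us)" and ?y = "word_prod (ys @ ws)"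
        have car': "set (ys @ ws) \<subseteq> carrier G" "set (vs @ us) \<subseteq> carrier G"
          using mixed right car by auto
        have "set (vs @ us) \<subseteq> I" using right hsI by auto
        then have k: "?k \<in> W\<^sub>I" by (rule word_generate)
        have "word_prod (ys @ zs @ us) = ?y \<otimes> ?k"
          using word_prod_append[OF car'] mixed by simp
        then have e: "x \<otimes> h = ?y \<otimes> ?k" using eq by simp
        have "?y = x \<otimes> (h \<otimes> inv ?k)"
        proof -
          have "x \<otimes> (h \<otimes> inv ?k) = (?y \<otimes> ?k) \<otimes> inv ?k"
            using e x(1) subgroup.mem_carrier[OF WI_subgroup] k h by (simp add: m_assoc[symmetric])
          also have "\<dots> = ?y" using word_prod_closed[OF car'(1)] word_prod_closed[OF car'(2)]
            by (simp add: m_assoc)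
          finally show ?thesis ..
        qed
        moreover have "h \<otimes> inv ?k \<in> W\<^sub>I"
          using WI_subgroup h k by (simp add: subgroup.m_closed subgroup.m_inv_closed)
        ultimately have "cox_length G S x \<le> cox_length G S ?y" using x(2) by simp
        moreover have "set (ys @ ws) \<subseteq> S" using xs mixed by auto
        ultimately show False using cox_length_le[of "ys @ ws"] mixed xs by simp
      next
        case in_hs
        \<comment> \<open>Both letters lie in \<open>hs\<close>: cancelling \<open>x\<close> on the
          left leaves a shorter word over \<open>I\<close> for \<open>h\<close>, against the choice
          of \<open>hs\<close>.\<close>
        let ?ks = "ws @ zs @ us"
        have ks: "set ?ks \<subseteq> I" using in_hs right hsI by auto
        then have ksc: "set ?ks \<subseteq> carrier G" using car by blast
        have "x \<otimes> h = x \<otimes> word_prod ?ks"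
          using eq in_hs word_prod_append[OF car(1) ksc] xs by simp
        then have "word_prod ?ks = h"
          using x(1) word_prod_closed[OF ksc] subgroup.mem_carrier[OF WI_subgroup h(1)]
          by (metis Units_eq Units_l_cancel)
        with ks have "P ?ks" by (simp add: P_def)
        from hs_min[OF this] show False using in_hs right by simp
      qed
    qed
  qed
qed

text \<open>This justifies the definite description: lengths are natural numbers, so a minimizer
  exists, and two minimizers differ by a factor in \<open>W\<^sub>I\<close> that
  \<open>min_in_coset_unique\<close> forces to be \<open>\<one>\<close>.\<close>

lemma min_rep:
  assumes "w \<in> carrier G"
  shows "min_rep G S I w \<in> w <# W\<^sub>I"
    and "y \<in> w <# W\<^sub>I \<Longrightarrow> cox_length G S (min_rep G S I w) \<le> cox_length G S y"
proof -
  let ?P = "\<lambda>x. x \<in> w <# W\<^sub>I \<and> (\<forall>y \<in> w <# W\<^sub>I. cox_length G S x \<le> cox_length G S y)"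
  obtain x where x: "?P x"
    using coset_self[OF assms] ex_has_least_nat[of "\<lambda>x. x \<in> w <# W\<^sub>I" w "cox_length G S"] by auto
  have xc: "x \<in> carrier G"
    using x l_coset_carrier[OF _ assms WI_subgroup] by blast
  have eq: "w <# W\<^sub>I = x <# W\<^sub>I"
    using x l_repr_independence[OF _ assms WI_subgroup] by blast
  have "z = x" if z: "?P z" for z
  proof -
    obtain h where h: "h \<in> W\<^sub>I" "z = x \<otimes> h" using z unfolding eq by (auto simp: l_coset_def)
    have "h = \<one>"
      using x z h(1) unfolding eq h(2)
      by (intro min_in_coset_unique[OF xc]) (auto simp: l_coset_def)
    then show ?thesis using h xc by simp
  qed
  then have "?P (min_rep G S I w)"
    unfolding min_rep_def using theI[of ?P x] x by blast
  then show "min_rep G S I w \<in> w <# W\<^sub>I"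
    "y \<in> w <# W\<^sub>I \<Longrightarrow> cox_length G S (min_rep G S I w) \<le> cox_length G S y" by blast+
qed

section \<open>Left-foldings of cosets\<close>

lemma WI_carrier: "W\<^sub>I \<subseteq> carrier G"
  using subgroup.subset[OF WI_subgroup] .

lemma one_coset: "\<one> <# W\<^sub>I = W\<^sub>I"
  using WI_carrier by (force simp: l_coset_def)

text \<open>The coset contains \<open>\<one>\<close>, of length 0, and no translate has a shorter
  representative.\<close>

lemma left_fold_WI: "left_fold G S I s W\<^sub>I = W\<^sub>I"
proof -
  have "cox_length G S (min_rep G S I w) = 0" if "w \<in> carrier G" "W\<^sub>I = w <# W\<^sub>I" for w
    using min_rep(2)[OF that(1), of \<one>] that(2) subgroup.one_closed[OF WI_subgroup]
      cox_length_le[of "[]"] by simp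
  then have "W\<^sub>I \<notin> R_cosets G S I s"
    unfolding R_cosets_def by fastforce
  then show ?thesis by (simp add: left_fold_def)
qed

lemma fold_left_fold_WI: "fold (left_fold G S I) ss W\<^sub>I = W\<^sub>I"
  by (induction ss) (auto simp: left_fold_WI)

lemma translate_coset:
  "s \<in> carrier G \<Longrightarrow> w \<in> carrier G \<Longrightarrow> s <# (w <# W\<^sub>I) = (s \<otimes> w) <# W\<^sub>I"
  using lcos_m_assoc WI_carrier by blast

lemma left_fold_closed:
  assumes "s \<in> S" "C \<in> parabolic_cosets G I"
  shows "left_fold G S I s C \<in> parabolic_cosets G I"
proof -
  obtain w where w: "w \<in> carrier G" "C = w <# W\<^sub>I"
    using assms(2) by (auto simp: parabolic_cosets_def LCOSETS_def)
  then have "s <# C = (s \<otimes> w) <# W\<^sub>I" "s \<otimes> w \<in> carrier G"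
    using assms(1) by (auto simp: translate_coset)
  then show ?thesis using assms(2)
    by (auto simp: left_fold_def parabolic_cosets_def LCOSETS_def)
qed

lemma fold_left_fold_closed:
  "set ss \<subseteq> S \<Longrightarrow> C \<in> parabolic_cosets G I \<Longrightarrow>
    fold (left_fold G S I) ss C \<in> parabolic_cosets G I"
  by (induction ss arbitrary: C) (auto simp: left_fold_closed)

lemma fold_coset_to_WI:
  assumes "w \<in> carrier G"
  shows "\<exists>ss. set ss \<subseteq> S \<and> fold (left_fold G S I) ss (w <# W\<^sub>I) = W\<^sub>I"
  using assms
proof (induction "cox_length G S (min_rep G S I w)" arbitrary: w rule: less_induct)
  case less
  define x where "x = min_rep G S I w"
  have x: "x \<in> w <# W\<^sub>I" using min_rep(1) less.prems by (simp add: x_def)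
  have xc: "x \<in> carrier G" using x l_coset_carrier[OF _ less.prems WI_subgroup] by blast
  have eq: "w <# W\<^sub>I = x <# W\<^sub>I" using x l_repr_independence[OF _ less.prems WI_subgroup] by blast
  \<comment> \<open>The representative depends only on the coset, so \<open>x\<close> represents
    itself and can witness membership in \<open>R_cosets\<close>.\<close>
  have "min_rep G S I x = min_rep G S I w" by (simp add: min_rep_def eq)
  then have mx: "min_rep G S I x = x" by (simp add: x_def)
  obtain xs where xs: "set xs \<subseteq> S" "word_prod xs = x" "length xs = cox_length G S x"
    using reduced_word xc by blast
  show ?case
  proof (cases xs)
    case Nil
    then show ?thesis using xs eq one_coset by (intro exI[of _ "[]"]) auto
  next
    case (Cons s ys)
    let ?y = "word_prod ys"
    have s: "s \<in> S" "set ys \<subseteq> S" using xs Cons by auto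
    then have yc: "?y \<in> carrier G" using S_carrier by (simp add: subset_trans)
    have sx: "s \<otimes> x = ?y"
      using xs(2) s yc Cons gen_square by (auto simp: m_assoc[symmetric])
    have "cox_length G S (min_rep G S I ?y) \<le> cox_length G S ?y"
      using min_rep(2)[OF yc coset_self[OF yc]] .
    also have "\<dots> \<le> length ys" using cox_length_le s by blast
    also have "\<dots> < cox_length G S x" using xs(3) Cons by simp
    finally have lt: "cox_length G S (min_rep G S I ?y) < cox_length G S x" .
    then obtain ss where ss: "set ss \<subseteq> S" "fold (left_fold G S I) ss (?y <# W\<^sub>I) = W\<^sub>I"
      using less.hyps[of ?y] yc unfolding x_def by blast
    have "x <# W\<^sub>I \<in> R_cosets G S I s"
      unfolding R_cosets_def using xc lt sx mx by auto
    then have "left_fold G S I s (w <# W\<^sub>I) = ?y <# W\<^sub>I"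
      using s xc sx by (simp add: left_fold_def eq translate_coset)
    \<comment> \<open>\<open>fold\<close> applies the head of the list first, so \<open>s\<close>
      goes in front.\<close>
    then show ?thesis using ss s by (intro exI[of _ "s # ss"]) auto
  qed
qed

text \<open>The word for the next coset \<open>C\<close> is chosen for the image of \<open>C\<close>
  under the earlier maps; cosets already brought to \<open>W\<^sub>I\<close> stay there, as it is a
  fixed point.\<close>

lemma fold_cosets_to_WI:
  assumes "finite A" "A \<subseteq> parabolic_cosets G I"
  shows "\<exists>ss. set ss \<subseteq> S \<and> (\<forall>C\<in>A. fold (left_fold G S I) ss C = W\<^sub>I)"
  using assms
proof (induction A rule: finite_induct)
  case empty
  then show ?case by (auto intro: exI[of _ "[]"])
next
  case (insert C A)
  then obtain ss where ss: "set ss \<subseteq> S" "\<forall>C\<in>A. fold (left_fold G S I) ss C = W\<^sub>I" by auto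
  have "fold (left_fold G S I) ss C \<in> parabolic_cosets G I"
    using fold_left_fold_closed ss insert by blast
  then obtain w where w: "w \<in> carrier G" "fold (left_fold G S I) ss C = w <# W\<^sub>I"
    by (auto simp: parabolic_cosets_def LCOSETS_def)
  obtain ss' where "set ss' \<subseteq> S" "fold (left_fold G S I) ss' (w <# W\<^sub>I) = W\<^sub>I"
    using fold_coset_to_WI w by blast
  with ss w show ?case
    by (intro exI[of _ "ss @ ss'"]) (auto simp: fold_left_fold_WI)
qed

section \<open>Folding sequences from words\<close>

lemma gen_reflection: "s \<in> S \<Longrightarrow> s \<in> reflections G S"
  unfolding reflections_def by (force intro: exI[of _ s] exI[of _ \<one>])

text \<open>The fibre of a composition arises by successive preimages. As \<open>fold\<close>
  applies the head \<open>s\<close> first, its preimage is taken last: a letter put in front of the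
  word appends a term to the sequence.\<close>

lemma folding_sequence_of_word:
  assumes "set ss \<subseteq> S"
  shows "\<exists>Js. finite_folding_sequence G S I Js \<and> hd Js = {W\<^sub>I} \<and>
    last Js = {C \<in> parabolic_cosets G I. fold (left_fold G S I) ss C = W\<^sub>I}"
  using assms
proof (induction ss)
  case Nil
  have "W\<^sub>I \<in> parabolic_cosets G I"
    using one_coset by (force simp: parabolic_cosets_def LCOSETS_def)
  then show ?case
    by (intro exI[of _ "[{W\<^sub>I}]"]) (auto simp: finite_folding_sequence_def)
next
  case (Cons s ss)
  then obtain Js where Js: "finite_folding_sequence G S I Js" "hd Js = {W\<^sub>I}"
    "last Js = {C \<in> parabolic_cosets G I. fold (left_fold G S I) ss C = W\<^sub>I}" by auto
  let ?J = "fold_plus G S I s (last Js)"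
  have ne: "Js \<noteq> []" using Js by (simp add: finite_folding_sequence_def)
  have step: "\<exists>t\<in>reflections G S. (Js @ [?J]) ! Suc i = fold_plus G S I t ((Js @ [?J]) ! i) \<or>
      (Js @ [?J]) ! Suc i = fold_minus G S I t ((Js @ [?J]) ! i)"
    if "Suc i < length (Js @ [?J])" for i
  proof (cases "Suc i < length Js")
    case True
    then show ?thesis using Js(1) by (simp add: finite_folding_sequence_def nth_append)
  next
    case False
    then have i: "Suc i = length Js" using that by simp
    then have "(Js @ [?J]) ! Suc i = ?J" "(Js @ [?J]) ! i = last Js"
      using ne by (auto simp: nth_append last_conv_nth simp flip: i)
    then show ?thesis using gen_reflection Cons.prems by auto
  qed
  have "finite_folding_sequence G S I (Js @ [?J])"
    unfolding finite_folding_sequence_def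
    using Js(1) step by (auto simp: finite_folding_sequence_def fold_plus_def)
  moreover have "?J = {C \<in> parabolic_cosets G I. fold (left_fold G S I) (s # ss) C = W\<^sub>I}"
    using left_fold_closed Cons.prems by (auto simp: fold_plus_def Js(3))
  ultimately show ?case using Js(2) ne by (intro exI[of _ "Js @ [?J]"]) auto
qed

lemma ex_percolating_sequence:
  assumes "finite (carrier G)"
  shows "\<exists>Js. percolating_sequence G S I Js \<and> hd Js = {W\<^sub>I}"
proof -
  have "parabolic_cosets G I = (\<lambda>w. w <# W\<^sub>I) ` carrier G"
    by (auto simp: parabolic_cosets_def LCOSETS_def)
  then have "finite (parabolic_cosets G I)" using assms by simp
  from fold_cosets_to_WI[OF this subset_refl] obtain ss where
    ss: "set ss \<subseteq> S" "\<forall>C\<in>parabolic_cosets G I. fold (left_fold G S I) ss C = W\<^sub>I" by blast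
  from folding_sequence_of_word[OF ss(1)] obtain Js where
    "finite_folding_sequence G S I Js" "hd Js = {W\<^sub>I}"
    "last Js = {C \<in> parabolic_cosets G I. fold (left_fold G S I) ss C = W\<^sub>I}" by blast
  with ss(2) show ?thesis
    by (intro exI[of _ Js]) (auto simp: percolating_sequence_def)
qed

end

end

theorem theorem3p3:
  fixes G :: "('a, 'b) monoid_scheme" and S I :: "'a set"
  assumes "finite_coxeter_system G S" and "I \<subseteq> S"
  shows "\<exists>Js. percolating_sequence G S I Js \<and> hd Js = {generate G I}"
proof -
  obtain m :: "'a \<Rightarrow> 'a \<Rightarrow> nat" where "group G" and fin: "finite (carrier G)"
    and m: "\<forall>s\<in>S. m s s = 1"
      "has_presentation G S {coxeter_relator s t (m s t) | s t. s \<in> S \<and> t \<in> S}"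
    using assms(1) unfolding finite_coxeter_system_def by blast
  interpret coxeter_presentation G S m
    using \<open>group G\<close> m by (intro coxeter_presentation.intro coxeter_presentation_axioms.intro) auto
  show ?thesis using ex_percolating_sequence[OF assms(2) fin] .
qed

end
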